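(* Let $\xi,\phi : I\to Q$ be regular unit speed real quaternionic involute-evolute curves, with arc-length parameters $s$ and $s^*$ respectively, $\phi$ being an involute of $\xi$. If $\xi$ is a quaternionic $w$-curve, then at corresponding points $$\xi(s)=\phi(s^* )+\rho(s^* )N_\phi(s^* )-\rho(s^* )\frac{k(s)}{\kappa_\xi(s)}E_\phi(s^* ),$$ where $\rho(s^* )=1/\kappa_\phi(s^* )$ is the radius of curvature of $\phi$.
   Context: $Q$ is the algebra of real quaternions, identified with Euclidean space $\mathbb{R}^4$; $I\subset\mathbb{R}$ is an interval; $\times$ is the quaternion product, $\hat q$ the conjugate, and $h(p,q)=\frac12(p\times\hat q+q\times\hat p)$ the quaternion inner product (equal to the Euclidean inner product of $\mathbb{R}^4$). A real quaternionic curve is a smooth curve $I\to Q$. The Serret-Frenet apparatus of a quaternionic curve $\xi$ with arc-length parameter $s$ consists of an orthonormal frame $\{T_\xi,N_\xi,B_\xi,E_\xi\}$ with $T_\xi=\xi'$ and curvatures $\kappa_\xi=\|T_\xi'\|$, $k$, $r-\kappa_\xi$ satisfying $$T_\xi'=\kappa_\xi N_\xi,\quad N_\xi'=-\kappa_\xi T_\xi+kB_\xi,\quad B_\xi'=-kN_\xi+(r-\kappa_\xi)E_\xi,\quad E_\xi'=-(r-\kappa_\xi)B_\xi .$$ The frame $\{T_\phi,N_\phi,B_\phi,E_\phi\}$ and curvatures $\kappa_\phi,k^*,r^*-\kappa_\phi$ of $\phi$ are defined in the same way with respect to $s^*$. The curves are assumed nondegenerate so that these frames are defined. The vector $E_\phi$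 is determined only up to a sign $\eta=\pm1$ (choice of orientation of the frame); the identity is understood for the appropriate choice of this sign. A $w$-curve is a curve all of whose curvatures are constant. Curves $\phi$ and $\xi$ with parameters $s^*$ and $s$, whose points are in a correspondence $s\leftrightarrow s^*$, are quaternionic involute-evolute curves ($\phi$ an involute of $\xi$) if $h(T_\phi(s^* ),T_\xi(s))=0$ at corresponding points and $\phi(s^* )$ lies on the tangent line of $\xi$ at $\xi(s)$; then $\phi(s^* )=\xi(s)+(c-s)T_\xi(s)$ for a constant $c$. *)

theory Defs
  imports "HOL-Analysis.Analysis"
begin

section \<open>Real quaternions\<close>

text \<open>
  A quaternion \<open>a + b i + c j + d k\<close> is the vector with components \<open>a, b, c, d\<close>
  at the indices 1, 2, 3, 4. Beware that the library operations \<open>*\<close> and \<open>1\<close> on \<open>real ^ 4\<close>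
  are componentwise; the quaternion product is \<open>\<times>\<^sub>Q\<close> and the quaternion unit is \<open>qreal 1\<close>.
\<close>

type_synonym quaternion = "real ^ 4"

definition qreal :: "real \<Rightarrow> quaternion" where
  "qreal a = vector [a, 0, 0, 0]"

definition qmult :: "quaternion \<Rightarrow> quaternion \<Rightarrow> quaternion" (infixl \<open>\<times>\<^sub>Q\<close> 70) where
  "p \<times>\<^sub>Q q = vector
    [p $ 1 * q $ 1 - p $ 2 * q $ 2 - p $ 3 * q $ 3 - p $ 4 * q $ 4,
     p $ 1 * q $ 2 + p $ 2 * q $ 1 + p $ 3 * q $ 4 - p $ 4 * q $ 3,
     p $ 1 * q $ 3 - p $ 2 * q $ 4 + p $ 3 * q $ 1 + p $ 4 * q $ 2,
     p $ 1 * q $ 4 + p $ 2 * q $ 3 - p $ 3 * q $ 2 + p $ 4 * q $ 1]"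

definition qconj :: "quaternion \<Rightarrow> quaternion" where
  "qconj q = vector [q $ 1, - q $ 2, - q $ 3, - q $ 4]"

text \<open>
  The quaternion inner product takes values in the real quaternions, embedded by \<^const>\<open>qreal\<close>.
\<close>

definition qinner :: "quaternion \<Rightarrow> quaternion \<Rightarrow> quaternion" where
  "qinner p q = (1 / 2) *\<^sub>R (p \<times>\<^sub>Q qconj q + q \<times>\<^sub>Q qconj p)"

lemma vector_4_nth [simp]:
  "(vector [a, b, c, d] :: 'a::zero ^ 4) $ 1 = a"
  "(vector [a, b, c, d] :: 'a::zero ^ 4) $ 2 = b"
  "(vector [a, b, c, d] :: 'a::zero ^ 4) $ 3 = c"
  "(vector [a, b, c, d] :: 'a::zero ^ 4) $ 4 = d"
  unfolding vector_def by simp_all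

lemma qinner_eq_inner: "qinner p q = qreal (p \<bullet> q)"
  by (simp add: vec_eq_iff forall_4 qinner_def qmult_def qconj_def qreal_def
      inner_vec_def sum_4 field_simps)

lemma qreal_eq_iff [simp]: "qreal a = qreal b \<longleftrightarrow> a = b"
  by (simp add: vec_eq_iff forall_4 qreal_def)

lemma qreal_0 [simp]: "qreal 0 = 0"
  by (simp add: vec_eq_iff forall_4 qreal_def)


section \<open>Curves on intervals\<close>

text \<open>
  Derivatives are taken within the interval, hence one-sided at endpoints belonging to it;
  the interval must have an interior point for these derivatives to be unique.
\<close>

definition smooth_on :: "real set \<Rightarrow> (real \<Rightarrow> 'a::real_normed_vector) \<Rightarrow> bool" where
  "smooth_on I f \<longleftrightarrow>
    (\<exists>D. D (0::nat) = f \<and>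
      (\<forall>n. \<forall>s\<in>I. (D n has_vector_derivative D (Suc n) s) (at s within I)))"

definition tangent :: "real set \<Rightarrow> (real \<Rightarrow> quaternion) \<Rightarrow> real \<Rightarrow> quaternion" where
  "tangent I \<gamma> s = vector_derivative \<gamma> (at s within I)"

definition unit_speed_curve :: "real set \<Rightarrow> (real \<Rightarrow> quaternion) \<Rightarrow> bool" where
  "unit_speed_curve I \<gamma> \<longleftrightarrow>
    is_interval I \<and> interior I \<noteq> {} \<and> smooth_on I \<gamma> \<and> (\<forall>s\<in>I. norm (tangent I \<gamma> s) = 1)"


section \<open>The Serret-Frenet apparatus\<close>

definition orthonormal_frame ::
    "quaternion \<Rightarrow> quaternion \<Rightarrow> quaternion \<Rightarrow> quaternion \<Rightarrow> bool" where
  "orthonormal_frame t n b e \<longleftrightarrow>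
    (\<forall>i<4. \<forall>j<4. qinner ([t, n, b, e] ! i) ([t, n, b, e] ! j) = qreal (if i = j then 1 else 0))"

text \<open>
  The third curvature is \<open>r - \<kappa>\<close>. Nondegeneracy means that \<open>\<kappa>\<close> and \<open>k\<close> do not vanish, that is,
  the first three derivatives of the curve are linearly independent; this determines
  \<open>N\<close>, and determines \<open>B\<close> and \<open>E\<close> up to sign. The third curvature may vanish.
\<close>

definition serret_frenet ::
    "real set \<Rightarrow> (real \<Rightarrow> quaternion) \<Rightarrow>
     (real \<Rightarrow> quaternion) \<Rightarrow> (real \<Rightarrow> quaternion) \<Rightarrow>
     (real \<Rightarrow> quaternion) \<Rightarrow> (real \<Rightarrow> quaternion) \<Rightarrow>
     (real \<Rightarrow> real) \<Rightarrow> (real \<Rightarrow> real) \<Rightarrow> (real \<Rightarrow> real) \<Rightarrow> bool" where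
  "serret_frenet I \<gamma> T N B E \<kappa> k r \<longleftrightarrow>
    (\<forall>s\<in>I.
      orthonormal_frame (T s) (N s) (B s) (E s) \<and>
      T s = tangent I \<gamma> s \<and>
      \<kappa> s = norm (vector_derivative T (at s within I)) \<and>
      (T has_vector_derivative \<kappa> s *\<^sub>R N s) (at s within I) \<and>
      (N has_vector_derivative - \<kappa> s *\<^sub>R T s + k s *\<^sub>R B s) (at s within I) \<and>
      (B has_vector_derivative - k s *\<^sub>R N s + (r s - \<kappa> s) *\<^sub>R E s) (at s within I) \<and>
      (E has_vector_derivative - (r s - \<kappa> s) *\<^sub>R B s) (at s within I) \<and>
      \<kappa> s \<noteq> 0 \<and> k s \<noteq> 0)"

definition w_curve ::
    "real set \<Rightarrow> (real \<Rightarrow> real) \<Rightarrow> (real \<Rightarrow> real) \<Rightarrow> (real \<Rightarrow> real) \<Rightarrow> bool" where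
  "w_curve I \<kappa> k r \<longleftrightarrow>
    \<kappa> constant_on I \<and> k constant_on I \<and> (\<lambda>s. r s - \<kappa> s) constant_on I"


section \<open>Involutes\<close>

text \<open>
  The correspondence sends the parameter \<open>s\<close> of \<open>\<xi>\<close> to the parameter \<open>\<sigma> s\<close> of the
  corresponding point of the involute \<open>\<phi>\<close>.
\<close>

definition involute_of ::
    "real set \<Rightarrow> (real \<Rightarrow> quaternion) \<Rightarrow> real set \<Rightarrow> (real \<Rightarrow> quaternion) \<Rightarrow>
     (real \<Rightarrow> real) \<Rightarrow> bool" where
  "involute_of J \<phi> I \<xi> \<sigma> \<longleftrightarrow>
    bij_betw \<sigma> I J \<and> smooth_on I \<sigma> \<and>
    (\<forall>s\<in>I. qinner (tangent J \<phi> (\<sigma> s)) (tangent I \<xi> s) = 0 \<and>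
           (\<exists>\<mu>. \<phi> (\<sigma> s) = \<xi> s + \<mu> *\<^sub>R tangent I \<xi> s))"

end

theory Submission
  imports Defs
begin

text \<open>
  Differentiating \<open>\<phi> \<circ> \<sigma> = \<xi> + (c - s) T\<^sub>\<xi>\<close> shows that \<open>T\<^sub>\<phi>\<close> is parallel to \<open>N\<^sub>\<xi>\<close>.
  A second differentiation shows that \<open>N\<^sub>\<phi>\<close> is parallel to \<open>- \<kappa> T\<^sub>\<xi> + k B\<^sub>\<xi>\<close>. When the
  curvatures are constant, a third one shows that \<open>B\<^sub>\<phi>\<close> is parallel to \<open>E\<^sub>\<xi>\<close>, so the remaining
  vector \<open>E\<^sub>\<phi>\<close> is parallel to \<open>k T\<^sub>\<xi> + \<kappa> B\<^sub>\<xi>\<close>. The proportionality factors are continuous functions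
  on an interval with values \<open>\<plusminus> 1\<close>, hence constant. Solving for \<open>T\<^sub>\<xi>\<close> gives the formula.
\<close>

section \<open>Orthonormal frames and unit vector fields\<close>

lemma orthonormal_frame_iff:
  "orthonormal_frame t n b e \<longleftrightarrow>
    t \<bullet> t = 1 \<and> n \<bullet> n = 1 \<and> b \<bullet> b = 1 \<and> e \<bullet> e = 1 \<and>
    t \<bullet> n = 0 \<and> t \<bullet> b = 0 \<and> t \<bullet> e = 0 \<and> n \<bullet> b = 0 \<and> n \<bullet> e = 0 \<and> b \<bullet> e = 0"
  unfolding orthonormal_frame_def qinner_eq_inner qreal_eq_iff
  by (auto simp: numeral_eq_Suc All_less_Suc inner_commute)

text \<open>Four orthonormal vectors are independent, hence span the 4-dimensional space. Both sides
  have the same inner product with each of them, so they agree.\<close>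

lemma orthonormal_frame_expand:
  assumes "orthonormal_frame t n b e"
  shows "x = (x \<bullet> t) *\<^sub>R t + (x \<bullet> n) *\<^sub>R n + (x \<bullet> b) *\<^sub>R b + (x \<bullet> e) *\<^sub>R e"
proof -
  have o: "t \<bullet> t = 1" "n \<bullet> n = 1" "b \<bullet> b = 1" "e \<bullet> e = 1"
    "t \<bullet> n = 0" "t \<bullet> b = 0" "t \<bullet> e = 0" "n \<bullet> b = 0" "n \<bullet> e = 0" "b \<bullet> e = 0"
    "n \<bullet> t = 0" "b \<bullet> t = 0" "e \<bullet> t = 0" "b \<bullet> n = 0" "e \<bullet> n = 0" "e \<bullet> b = 0"
    using assms by (auto simp: orthonormal_frame_iff inner_commute)
  define S where "S = {t, n, b, e}"
  have d: "t \<noteq> n" "t \<noteq> b" "t \<noteq> e" "n \<noteq> b" "n \<noteq> e" "b \<noteq> e"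
    using o by auto
  have card: "card S = 4" using d by (simp add: S_def)
  have orth: "pairwise orthogonal S"
    using o by (auto simp: S_def pairwise_def orthogonal_def)
  moreover have "0 \<notin> S" using o by (auto simp: S_def)
  ultimately have "independent S" by (rule pairwise_orthogonal_independent)
  then have "UNIV \<subseteq> span S"
    by (intro card_ge_dim_independent) (auto simp: card)
  then have "span S = UNIV" by blast
  then have "(\<Sum>i\<in>S. (x \<bullet> i) *\<^sub>R i) = x"
    using o
    by (intro vector_eq_dot_span[where B = S])
      (auto simp: S_def d inner_add_right inner_commute[of _ x])
  then show ?thesis using d by (simp add: S_def add.assoc)
qed

text \<open>The inner product of the two fields is continuous with values \<open>1\<close> and
  \<open>- 1\<close> on a connected set, so it is a constant \<epsilon>; then the squared norm of
  \<open>u s - \<epsilon> *\<^sub>R v s\<close> is zero. Because the sign does not depend on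
  \<open>s\<close>, the resulting relation can be differentiated.\<close>

lemma unit_fields_parallel_sign:
  fixes u v :: "'b::topological_space \<Rightarrow> 'a::real_inner"
  assumes "connected I" "continuous_on I u" "continuous_on I v"
    and u: "\<And>s. s \<in> I \<Longrightarrow> u s \<bullet> u s = 1"
    and v: "\<And>s. s \<in> I \<Longrightarrow> v s \<bullet> v s = 1"
    and uv: "\<And>s. s \<in> I \<Longrightarrow> (u s \<bullet> v s)\<^sup>2 = 1"
  shows "\<exists>\<epsilon>\<in>{1, - 1}. \<forall>s\<in>I. u s = \<epsilon> *\<^sub>R v s"
proof (cases "I = {}")
  case False
  have "(\<lambda>s. u s \<bullet> v s) ` I \<subseteq> {1, - 1}"
    using uv by (auto simp: power2_eq_1_iff)
  then have "finite ((\<lambda>s. u s \<bullet> v s) ` I)"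
    by (rule finite_subset) simp
  then have "(\<lambda>s. u s \<bullet> v s) constant_on I"
    by (intro continuous_finite_range_constant assms continuous_on_inner)
  then obtain \<epsilon> where \<epsilon>: "\<And>s. s \<in> I \<Longrightarrow> u s \<bullet> v s = \<epsilon>"
    by (auto simp: constant_on_def)
  have \<epsilon>2: "\<epsilon>\<^sup>2 = 1" using False uv \<epsilon> by auto
  have "u s = \<epsilon> *\<^sub>R v s" if "s \<in> I" for s
  proof -
    have "(u s - \<epsilon> *\<^sub>R v s) \<bullet> (u s - \<epsilon> *\<^sub>R v s) = 1 - 2 * \<epsilon> * \<epsilon> + \<epsilon>\<^sup>2"
      using u[OF that] v[OF that] \<epsilon>[OF that]
      by (simp add: inner_diff_left inner_diff_right inner_commute power2_eq_square)
    then show ?thesis using \<epsilon>2 by (simp add: power2_eq_square)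
  qed
  moreover have "\<epsilon> \<in> {1, - 1}" using \<epsilon>2 by (simp add: power2_eq_1_iff)
  ultimately show ?thesis by blast
qed auto

text \<open>Supplies the last hypothesis of the sign lemma: from
  \<open>x *\<^sub>R u = z *\<^sub>R v\<close> with unit vectors, the product with \<open>v\<close>
  gives the first premise for \<open>y = u \<bullet> v\<close>, and squared norms give the
  second.\<close>

lemma square_eq_1_of_mult:
  fixes x y z :: real
  assumes "x * y = z" "x\<^sup>2 = z\<^sup>2" "z \<noteq> 0"
  shows "y\<^sup>2 = 1"
proof -
  have "z\<^sup>2 * y\<^sup>2 = z\<^sup>2" using assms(1,2) by (metis power_mult_distrib)
  then show ?thesis using assms(3) by simp
qed

text \<open>An interval with interior is not a singleton, so by connectedness each of its points is
  a limit point. Uniqueness of derivatives and limits within \<open>I\<close> rests on this.\<close>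

lemma interval_at_within_neq_bot:
  fixes I :: "real set"
  assumes "is_interval I" "interior I \<noteq> {}" "s \<in> I"
  shows "at s within I \<noteq> bot"
proof -
  have "I \<noteq> {x}" for x using assms(2) by auto
  then have "s islimpt I"
    using assms by (intro connected_imp_perfect is_interval_connected)
  then show ?thesis by (simp add: trivial_limit_within)
qed

lemma smooth_on_has_vector_derivative:
  assumes "smooth_on I f" "s \<in> I"
  shows "(f has_vector_derivative vector_derivative f (at s within I)) (at s within I)"
  using assms unfolding smooth_on_def
  by (metis differentiableI_vector vector_derivative_works)

theorem theorem3p6:
  fixes I J :: "real set"
    and \<xi> \<phi> :: "real \<Rightarrow> quaternion"
    and T\<^sub>\<xi> N\<^sub>\<xi> B\<^sub>\<xi> E\<^sub>\<xi> :: "real \<Rightarrow> quaternion"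
    and T\<^sub>\<phi> N\<^sub>\<phi> B\<^sub>\<phi> E\<^sub>\<phi> :: "real \<Rightarrow> quaternion"
    and \<kappa>\<^sub>\<xi> k r \<kappa>\<^sub>\<phi> k' r' \<sigma> :: "real \<Rightarrow> real"
  assumes "unit_speed_curve I \<xi>"
    and "unit_speed_curve J \<phi>"
    and "serret_frenet I \<xi> T\<^sub>\<xi> N\<^sub>\<xi> B\<^sub>\<xi> E\<^sub>\<xi> \<kappa>\<^sub>\<xi> k r"
    and "serret_frenet J \<phi> T\<^sub>\<phi> N\<^sub>\<phi> B\<^sub>\<phi> E\<^sub>\<phi> \<kappa>\<^sub>\<phi> k' r'"
    and "involute_of J \<phi> I \<xi> \<sigma>"
    and "w_curve I \<kappa>\<^sub>\<xi> k r"
  shows "let \<rho> = (\<lambda>t. 1 / \<kappa>\<^sub>\<phi> t) in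
    \<exists>\<eta>\<in>{1, - 1}. \<forall>s\<in>I.
      \<xi> s = \<phi> (\<sigma> s) + \<rho> (\<sigma> s) *\<^sub>R N\<^sub>\<phi> (\<sigma> s)
            - (\<rho> (\<sigma> s) * (k s / \<kappa>\<^sub>\<xi> s)) *\<^sub>R (\<eta> *\<^sub>R E\<^sub>\<phi> (\<sigma> s))"
proof -

  \<comment> \<open>Frenet equations pulled back along the correspondence\<close>
  let ?D = "\<lambda>f s. vector_derivative f (at s within I)"
  define \<tau> where "\<tau> s = r s - \<kappa>\<^sub>\<xi> s" for s
  define \<sigma>' where "\<sigma>' = ?D \<sigma>"
  have int: "is_interval I" "interior I \<noteq> {}" and smooth_\<xi>: "smooth_on I \<xi>"
    using assms(1) by (auto simp: unit_speed_curve_def)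
  have conn: "connected I" and conv: "convex I"
    using int(1) by (auto simp: is_interval_connected is_interval_convex)
  have nb: "at s within I \<noteq> bot" if "s \<in> I" for s
    using interval_at_within_neq_bot int that by blast
  have img: "\<sigma> ` I = J"
    using assms(5) by (auto simp: involute_of_def bij_betw_def)
  then have \<sigma>_in: "\<sigma> s \<in> J" if "s \<in> I" for s using that by auto
  have d\<sigma>: "(\<sigma> has_vector_derivative \<sigma>' s) (at s within I)" if "s \<in> I" for s
    using assms(5) that unfolding \<sigma>'_def involute_of_def
    by (intro smooth_on_has_vector_derivative) auto
  \<comment> \<open>Since \<sigma> maps \<open>I\<close> onto \<open>J\<close>, a derivative within
    \<open>J\<close> is one within the image of \<open>I\<close>, as the chain rule
    requires.\<close>
  have chain: "((\<lambda>s. f (\<sigma> s)) has_vector_derivative \<sigma>' s *\<^sub>R f') (at s within I)"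
    if "(f has_vector_derivative f') (at (\<sigma> s) within J)" "s \<in> I" for f :: "real \<Rightarrow> quaternion" and f' s
    using vector_diff_chain_within[OF d\<sigma>[OF that(2)], of f f'] that(1) img by (simp add: o_def)

  have frame: "orthonormal_frame (T\<^sub>\<xi> s) (N\<^sub>\<xi> s) (B\<^sub>\<xi> s) (E\<^sub>\<xi> s)"
    and T_eq: "T\<^sub>\<xi> s = tangent I \<xi> s"
    and dT: "(T\<^sub>\<xi> has_vector_derivative \<kappa>\<^sub>\<xi> s *\<^sub>R N\<^sub>\<xi> s) (at s within I)"
    and dN: "(N\<^sub>\<xi> has_vector_derivative - \<kappa>\<^sub>\<xi> s *\<^sub>R T\<^sub>\<xi> s + k s *\<^sub>R B\<^sub>\<xi> s) (at s within I)"
    and dB: "(B\<^sub>\<xi> has_vector_derivative - k s *\<^sub>R N\<^sub>\<xi> s + \<tau> s *\<^sub>R E\<^sub>\<xi> s) (at s within I)"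
    and \<kappa>0: "\<kappa>\<^sub>\<xi> s \<noteq> 0" and k0: "k s \<noteq> 0"
    if "s \<in> I" for s
    using assms(3) that by (auto simp: serret_frenet_def \<tau>_def)
  have frame': "orthonormal_frame (T\<^sub>\<phi> (\<sigma> s)) (N\<^sub>\<phi> (\<sigma> s)) (B\<^sub>\<phi> (\<sigma> s)) (E\<^sub>\<phi> (\<sigma> s))"
    and T'_eq: "T\<^sub>\<phi> (\<sigma> s) = tangent J \<phi> (\<sigma> s)"
    and dT': "((\<lambda>s. T\<^sub>\<phi> (\<sigma> s)) has_vector_derivative
      \<sigma>' s *\<^sub>R \<kappa>\<^sub>\<phi> (\<sigma> s) *\<^sub>R N\<^sub>\<phi> (\<sigma> s)) (at s within I)"
    and dN': "((\<lambda>s. N\<^sub>\<phi> (\<sigma> s)) has_vector_derivative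
      \<sigma>' s *\<^sub>R (- \<kappa>\<^sub>\<phi> (\<sigma> s) *\<^sub>R T\<^sub>\<phi> (\<sigma> s) + k' (\<sigma> s) *\<^sub>R B\<^sub>\<phi> (\<sigma> s))) (at s within I)"
    and dE': "((\<lambda>s. E\<^sub>\<phi> (\<sigma> s)) has_vector_derivative
      \<sigma>' s *\<^sub>R (- (r' (\<sigma> s) - \<kappa>\<^sub>\<phi> (\<sigma> s)) *\<^sub>R B\<^sub>\<phi> (\<sigma> s))) (at s within I)"
    and \<kappa>'0: "\<kappa>\<^sub>\<phi> (\<sigma> s) \<noteq> 0" and k'0: "k' (\<sigma> s) \<noteq> 0"
    if "s \<in> I" for s
    using assms(4) \<sigma>_in[OF that] chain[OF _ that] unfolding serret_frenet_def by blast+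
  have cont: "continuous_on I f" if "\<And>s. s \<in> I \<Longrightarrow> (f has_vector_derivative f' s) (at s within I)"
    for f :: "real \<Rightarrow> quaternion" and f'
    using that by (meson continuous_on_vector_derivative)
  note cont_T = cont[OF dT] and cont_N = cont[OF dN] and cont_B = cont[OF dB]
    and cont_T' = cont[OF dT'] and cont_N' = cont[OF dN'] and cont_E' = cont[OF dE']
  note on = frame[unfolded orthonormal_frame_iff] and on' = frame'[unfolded orthonormal_frame_iff]

  \<comment> \<open>Displacement of the involute along the tangent line\<close>
  define \<mu> where "\<mu> s = (\<phi> (\<sigma> s) - \<xi> s) \<bullet> T\<^sub>\<xi> s" for s
  have TT': "T\<^sub>\<phi> (\<sigma> s) \<bullet> T\<^sub>\<xi> s = 0" and \<phi>_eq: "\<phi> (\<sigma> s) = \<xi> s + \<mu> s *\<^sub>R T\<^sub>\<xi> s" if s: "s \<in> I" for s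
  proof -
    have "qreal (T\<^sub>\<phi> (\<sigma> s) \<bullet> T\<^sub>\<xi> s) = qreal 0"
      using assms(5) s by (simp add: involute_of_def T_eq T'_eq flip: qinner_eq_inner)
    then show "T\<^sub>\<phi> (\<sigma> s) \<bullet> T\<^sub>\<xi> s = 0" by (simp only: qreal_eq_iff)
    obtain m where "\<phi> (\<sigma> s) = \<xi> s + m *\<^sub>R T\<^sub>\<xi> s"
      using assms(5) s by (auto simp: involute_of_def T_eq)
    then show "\<phi> (\<sigma> s) = \<xi> s + \<mu> s *\<^sub>R T\<^sub>\<xi> s" using on[OF s] by (simp add: \<mu>_def)
  qed
  have d\<xi>: "(\<xi> has_vector_derivative T\<^sub>\<xi> s) (at s within I)" if "s \<in> I" for s
    using smooth_on_has_vector_derivative[OF smooth_\<xi> that] that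
    by (simp add: T_eq tangent_def)
  have d\<phi>: "((\<lambda>s. \<phi> (\<sigma> s)) has_vector_derivative \<sigma>' s *\<^sub>R T\<^sub>\<phi> (\<sigma> s)) (at s within I)" if "s \<in> I" for s
    using smooth_on_has_vector_derivative[of J \<phi> "\<sigma> s"] assms(2) that \<sigma>_in[OF that]
    by (intro chain) (auto simp: T'_eq tangent_def unit_speed_curve_def)

  \<comment> \<open>Being an inner product of differentiable fields, \<mu> inherits their
    regularity; the pointwise witnesses in \<open>involute_of\<close> carry none by
    themselves.\<close>
  have "\<mu> differentiable (at s within I)" if "s \<in> I" for s
    unfolding \<mu>_def using d\<xi>[OF that] d\<phi>[OF that] dT[OF that]
    by (intro differentiable_inner differentiable_diff) (auto intro: differentiableI_vector)
  then have d\<mu>0: "(\<mu> has_vector_derivative ?D \<mu> s) (at s within I)" if "s \<in> I" for s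
    using that by (simp add: vector_derivative_works)
  have eq1: "\<sigma>' s *\<^sub>R T\<^sub>\<phi> (\<sigma> s) = T\<^sub>\<xi> s + (\<mu> s *\<^sub>R \<kappa>\<^sub>\<xi> s *\<^sub>R N\<^sub>\<xi> s + ?D \<mu> s *\<^sub>R T\<^sub>\<xi> s)"
    if s: "s \<in> I" for s
  proof (rule vector_derivative_unique_within[OF nb[OF s] d\<phi>[OF s]])
    have "((\<lambda>s. \<xi> s + \<mu> s *\<^sub>R T\<^sub>\<xi> s) has_vector_derivative
        T\<^sub>\<xi> s + (\<mu> s *\<^sub>R \<kappa>\<^sub>\<xi> s *\<^sub>R N\<^sub>\<xi> s + ?D \<mu> s *\<^sub>R T\<^sub>\<xi> s)) (at s within I)"
      using d\<mu>0[OF s] by (intro has_vector_derivative_add d\<xi> has_vector_derivative_scaleR dT s)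
        (simp add: has_real_derivative_iff_has_vector_derivative)
    then show "((\<lambda>s. \<phi> (\<sigma> s)) has_vector_derivative
        T\<^sub>\<xi> s + (\<mu> s *\<^sub>R \<kappa>\<^sub>\<xi> s *\<^sub>R N\<^sub>\<xi> s + ?D \<mu> s *\<^sub>R T\<^sub>\<xi> s)) (at s within I)"
      by (rule has_vector_derivative_transform[rotated 2]) (auto simp: s \<phi>_eq)
  qed
  \<comment> \<open>The product with \<open>T\<^sub>\<xi> s\<close> kills the left side by
    orthogonality and leaves \<open>1 + ?D \<mu> s = 0\<close>.\<close>
  have D\<mu>: "?D \<mu> s = - 1" if s: "s \<in> I" for s
    using arg_cong[OF eq1[OF s], of "\<lambda>x. x \<bullet> T\<^sub>\<xi> s"] TT'[OF s] on[OF s]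
    by (simp add: inner_add_left inner_add_right inner_commute)
  have eq1: "\<sigma>' s *\<^sub>R T\<^sub>\<phi> (\<sigma> s) = (\<mu> s * \<kappa>\<^sub>\<xi> s) *\<^sub>R N\<^sub>\<xi> s" if "s \<in> I" for s
    using eq1[OF that] D\<mu>[OF that] by simp
  have "\<exists>c. \<forall>s\<in>I. \<mu> s + s = c"
  proof -
    have "((\<lambda>s. \<mu> s + s) has_vector_derivative 0) (at s within I)" if "s \<in> I" for s
      using has_vector_derivative_add[OF d\<mu>0[OF that] has_vector_derivative_id] D\<mu>[OF that] by simp
    from has_vector_derivative_zero_constant[OF conv this]
    obtain c where "\<And>s. s \<in> I \<Longrightarrow> \<mu> s + s = c" by blast
    then show ?thesis by blast
  qed
  then obtain c where "\<forall>s\<in>I. \<mu> s + s = c" ..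
  then have \<mu>_c: "\<mu> s = c - s" if "s \<in> I" for s using that by (simp add: algebra_simps)

  \<comment> \<open>The tangent of the involute\<close>
  have sq_off: "(T\<^sub>\<phi> (\<sigma> s) \<bullet> N\<^sub>\<xi> s)\<^sup>2 = 1" if s: "s \<in> I" and "s \<noteq> c" for s
  proof -
    have "\<sigma>' s * (T\<^sub>\<phi> (\<sigma> s) \<bullet> N\<^sub>\<xi> s) = \<mu> s * \<kappa>\<^sub>\<xi> s"
      using arg_cong[OF eq1[OF s], of "\<lambda>x. x \<bullet> N\<^sub>\<xi> s"] on[OF s] by simp
    moreover have "(\<sigma>' s)\<^sup>2 = (\<mu> s * \<kappa>\<^sub>\<xi> s)\<^sup>2"
      using arg_cong[OF eq1[OF s], of "\<lambda>x. x \<bullet> x"] on[OF s] on'[OF s]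
      by (simp add: power2_eq_square)
    moreover have "\<mu> s * \<kappa>\<^sub>\<xi> s \<noteq> 0" using \<mu>_c s that(2) \<kappa>0 by simp
    ultimately show ?thesis by (rule square_eq_1_of_mult)
  qed
  \<comment> \<open>At the parameter \<open>c\<close>, where the involute would touch \<open>\<xi>\<close>, the identity extends by continuity.\<close>
  have sq: "(T\<^sub>\<phi> (\<sigma> s) \<bullet> N\<^sub>\<xi> s)\<^sup>2 = 1" if s: "s \<in> I" for s
  proof (cases "s = c")
    case True
    let ?g = "\<lambda>s. (T\<^sub>\<phi> (\<sigma> s) \<bullet> N\<^sub>\<xi> s)\<^sup>2"
    have "continuous_on I ?g"
      by (intro continuous_intros cont_T' cont_N)
    then have "(?g \<longlongrightarrow> ?g s) (at s within I)" using s by (simp add: continuous_on_def)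
    moreover have "eventually (\<lambda>x. ?g x = 1) (at s within I)"
      using sq_off True by (auto simp: eventually_at_filter)
    then have "(?g \<longlongrightarrow> 1) (at s within I)" by (rule tendsto_eventually)
    ultimately show ?thesis by (rule tendsto_unique[OF nb[OF s]])
  qed (use sq_off s in blast)
  have "\<exists>\<epsilon>\<in>{1, - 1}. \<forall>s\<in>I. T\<^sub>\<phi> (\<sigma> s) = \<epsilon> *\<^sub>R N\<^sub>\<xi> s"
    by (rule unit_fields_parallel_sign[OF conn cont_T' cont_N]) (auto simp: on on' sq)
  then obtain \<epsilon> where \<epsilon>: "\<epsilon> \<in> {1, - 1}" and T'_N: "\<And>s. s \<in> I \<Longrightarrow> T\<^sub>\<phi> (\<sigma> s) = \<epsilon> *\<^sub>R N\<^sub>\<xi> s"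
    by blast
  have \<epsilon>\<epsilon>: "\<epsilon> * \<epsilon> = 1" using \<epsilon> by auto
  \<comment> \<open>First of two formulas for \<open>\<sigma>'\<close>; comparing it with
    \<open>\<sigma>\<kappa>\<close> below determines \<mu>.\<close>
  have \<sigma>'_eq: "\<sigma>' s = \<epsilon> * \<mu> s * \<kappa>\<^sub>\<xi> s" if s: "s \<in> I" for s
  proof -
    have "\<sigma>' s * \<epsilon> = \<mu> s * \<kappa>\<^sub>\<xi> s"
      using arg_cong[OF eq1[OF s], of "\<lambda>x. x \<bullet> N\<^sub>\<xi> s"] on[OF s] T'_N[OF s] by simp
    then show ?thesis using \<epsilon> by auto
  qed

  \<comment> \<open>An adapted orthonormal pair in the plane of \<open>T\<^sub>\<xi>\<close> and
    \<open>B\<^sub>\<xi>\<close>\<close>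
  obtain K kk where K: "\<And>s. s \<in> I \<Longrightarrow> \<kappa>\<^sub>\<xi> s = K" "\<And>s. s \<in> I \<Longrightarrow> k s = kk"
    using assms(6) by (auto simp: w_curve_def constant_on_def)
  \<comment> \<open>\<open>W\<close> is the norm of the derivative of \<open>N\<^sub>\<xi>\<close>,
    \<open>U\<close> is the direction of that derivative, and \<open>V\<close> is the unit vector
    orthogonal to \<open>U\<close> in the same plane. \<open>K\<close> and \<open>kk\<close> are
    tied to the curvatures only at points of \<open>I\<close>, hence the premise
    \<open>s \<in> I\<close> in the facts below.\<close>
  define W where "W = sqrt (K\<^sup>2 + kk\<^sup>2)"
  define U where "U s = (- K / W) *\<^sub>R T\<^sub>\<xi> s + (kk / W) *\<^sub>R B\<^sub>\<xi> s" for s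
  define V where "V s = (kk / W) *\<^sub>R T\<^sub>\<xi> s + (K / W) *\<^sub>R B\<^sub>\<xi> s" for s
  have WW: "W * W = K * K + kk * kk" by (simp add: W_def power2_eq_square)
  have W0: "W \<noteq> 0" if "s \<in> I" for s
    using \<kappa>0[OF that] K[OF that] by (simp add: W_def add_nonneg_eq_0_iff)
  have norm1: "K / W * (K / W) + kk / W * (kk / W) = 1" if "s \<in> I" for s
    using W0[OF that] by (simp flip: WW add_divide_distrib)
  have UU: "U s \<bullet> U s = 1" and VV: "V s \<bullet> V s = 1" if s: "s \<in> I" for s
    using norm1[OF s] on[OF s]
    by (simp_all add: U_def V_def inner_add_left inner_add_right inner_diff_left inner_diff_right
        inner_commute add.commute)
  have contU: "continuous_on I U" and contV: "continuous_on I V"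
    unfolding U_def V_def by (intro continuous_intros cont_T cont_B; assumption)+

  \<comment> \<open>The principal normal of the involute\<close>
  have eq2: "(\<sigma>' s * \<kappa>\<^sub>\<phi> (\<sigma> s)) *\<^sub>R N\<^sub>\<phi> (\<sigma> s) = (\<epsilon> * W) *\<^sub>R U s" if s: "s \<in> I" for s
  proof -
    \<comment> \<open>Both sides are derivatives of \<open>T\<^sub>\<phi>\<close> along \<sigma>,
      the right one through its expression as \<epsilon> times \<open>N\<^sub>\<xi>\<close>.\<close>
    have "\<sigma>' s *\<^sub>R \<kappa>\<^sub>\<phi> (\<sigma> s) *\<^sub>R N\<^sub>\<phi> (\<sigma> s) = \<epsilon> *\<^sub>R (- \<kappa>\<^sub>\<xi> s *\<^sub>R T\<^sub>\<xi> s + k s *\<^sub>R B\<^sub>\<xi> s)"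
    proof (rule vector_derivative_unique_within[OF nb[OF s] dT'[OF s]])
      have "((\<lambda>s. \<epsilon> *\<^sub>R N\<^sub>\<xi> s) has_vector_derivative
          \<epsilon> *\<^sub>R (- \<kappa>\<^sub>\<xi> s *\<^sub>R T\<^sub>\<xi> s + k s *\<^sub>R B\<^sub>\<xi> s)) (at s within I)"
        by (rule bounded_linear.has_vector_derivative[OF bounded_linear_scaleR_right dN[OF s]])
      then show "((\<lambda>s. T\<^sub>\<phi> (\<sigma> s)) has_vector_derivative
          \<epsilon> *\<^sub>R (- \<kappa>\<^sub>\<xi> s *\<^sub>R T\<^sub>\<xi> s + k s *\<^sub>R B\<^sub>\<xi> s)) (at s within I)"
        by (rule has_vector_derivative_transform[rotated 2]) (auto simp: s T'_N)
    qed
    then show ?thesis using K[OF s] W0[OF s] by (simp add: U_def algebra_simps)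
  qed
  have sqU: "(N\<^sub>\<phi> (\<sigma> s) \<bullet> U s)\<^sup>2 = 1" if s: "s \<in> I" for s
  proof -
    have "\<sigma>' s * \<kappa>\<^sub>\<phi> (\<sigma> s) * (N\<^sub>\<phi> (\<sigma> s) \<bullet> U s) = \<epsilon> * W"
      using arg_cong[OF eq2[OF s], of "\<lambda>x. x \<bullet> U s"] UU[OF s] by simp
    moreover have "(\<sigma>' s * \<kappa>\<^sub>\<phi> (\<sigma> s))\<^sup>2 = (\<epsilon> * W)\<^sup>2"
      using arg_cong[OF eq2[OF s], of "\<lambda>x. x \<bullet> x"] UU[OF s] on'[OF s]
      by (simp add: power2_eq_square)
    moreover have "\<epsilon> * W \<noteq> 0" using \<epsilon> W0[OF s] by auto
    ultimately show ?thesis by (rule square_eq_1_of_mult)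
  qed
  have "\<exists>\<delta>\<in>{1, - 1}. \<forall>s\<in>I. N\<^sub>\<phi> (\<sigma> s) = \<delta> *\<^sub>R U s"
    by (rule unit_fields_parallel_sign[OF conn cont_N' contU]) (auto simp: UU on' sqU)
  then obtain \<delta> where \<delta>: "\<delta> \<in> {1, - 1}" and N'_U: "\<And>s. s \<in> I \<Longrightarrow> N\<^sub>\<phi> (\<sigma> s) = \<delta> *\<^sub>R U s"
    by blast
  have \<sigma>\<kappa>: "\<sigma>' s * \<kappa>\<^sub>\<phi> (\<sigma> s) = \<epsilon> * \<delta> * W" if s: "s \<in> I" for s
  proof -
    have "\<sigma>' s * \<kappa>\<^sub>\<phi> (\<sigma> s) * \<delta> = \<epsilon> * W"
      using arg_cong[OF eq2[OF s], of "\<lambda>x. x \<bullet> U s"] UU[OF s] N'_U[OF s] by simp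
    then show ?thesis using \<delta> by auto
  qed

  \<comment> \<open>The binormal of the involute\<close>
  have eq3: "(\<sigma>' s * k' (\<sigma> s)) *\<^sub>R B\<^sub>\<phi> (\<sigma> s) = (\<delta> * (kk * \<tau> s / W)) *\<^sub>R E\<^sub>\<xi> s" if s: "s \<in> I" for s
  proof -
    have "\<sigma>' s *\<^sub>R (- \<kappa>\<^sub>\<phi> (\<sigma> s) *\<^sub>R T\<^sub>\<phi> (\<sigma> s) + k' (\<sigma> s) *\<^sub>R B\<^sub>\<phi> (\<sigma> s)) =
        \<delta> *\<^sub>R ((- K / W) *\<^sub>R (\<kappa>\<^sub>\<xi> s *\<^sub>R N\<^sub>\<xi> s) + (kk / W) *\<^sub>R (- k s *\<^sub>R N\<^sub>\<xi> s + \<tau> s *\<^sub>R E\<^sub>\<xi> s))"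
      (is "_ = ?R")
    proof (rule vector_derivative_unique_within[OF nb[OF s] dN'[OF s]])
      have "((\<lambda>s. \<delta> *\<^sub>R U s) has_vector_derivative ?R) (at s within I)"
        unfolding U_def
        by (intro bounded_linear.has_vector_derivative[OF bounded_linear_scaleR_right]
            has_vector_derivative_add dT dB s)
      then show "((\<lambda>s. N\<^sub>\<phi> (\<sigma> s)) has_vector_derivative ?R) (at s within I)"
        by (rule has_vector_derivative_transform[rotated 2]) (auto simp: s N'_U)
    qed
    \<comment> \<open>With constant coefficients in \<open>U\<close>, its derivative has no
      component along \<open>T\<^sub>\<xi>\<close> or \<open>B\<^sub>\<xi>\<close>. Its
      \<open>N\<^sub>\<xi>\<close> part has total coefficient \<open>- W\<close> and cancels the
      \<open>T\<^sub>\<phi>\<close> term on the left.\<close>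
    also have "?R = (\<delta> * (kk * \<tau> s / W)) *\<^sub>R E\<^sub>\<xi> s - (\<delta> * ((K * K + kk * kk) / W)) *\<^sub>R N\<^sub>\<xi> s"
      by (simp add: K[OF s] algebra_simps add_divide_distrib)
    also have "(K * K + kk * kk) / W = W" using W0[OF s] by (simp flip: WW)
    finally have "(\<sigma>' s * k' (\<sigma> s)) *\<^sub>R B\<^sub>\<phi> (\<sigma> s) - (\<sigma>' s * \<kappa>\<^sub>\<phi> (\<sigma> s)) *\<^sub>R T\<^sub>\<phi> (\<sigma> s) =
        (\<delta> * (kk * \<tau> s / W)) *\<^sub>R E\<^sub>\<xi> s - (\<delta> * W) *\<^sub>R N\<^sub>\<xi> s"
      by (simp add: algebra_simps)
    moreover have "(\<sigma>' s * \<kappa>\<^sub>\<phi> (\<sigma> s)) *\<^sub>R T\<^sub>\<phi> (\<sigma> s) = (\<delta> * W) *\<^sub>R N\<^sub>\<xi> s"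
      using \<epsilon> by (auto simp: \<sigma>\<kappa>[OF s] T'_N[OF s])
    ultimately show ?thesis by simp
  qed

  \<comment> \<open>The last frame vector of the involute\<close>
  have E'_E: "E\<^sub>\<phi> (\<sigma> s) \<bullet> E\<^sub>\<xi> s = 0" if s: "s \<in> I" for s
  proof -
    have "\<sigma>' s \<noteq> 0" using \<sigma>\<kappa>[OF s] \<epsilon> \<delta> W0[OF s] by auto
    \<comment> \<open>The left side of \<open>eq3\<close> is nonzero because \<open>k'\<close> does
      not vanish. Hence so is the right side, which makes \<open>E\<^sub>\<xi>\<close> a multiple of
      \<open>B\<^sub>\<phi>\<close> and thus orthogonal to \<open>E\<^sub>\<phi>\<close>.\<close>
    then have "\<delta> * (kk * \<tau> s / W) \<noteq> 0"
      using arg_cong[OF eq3[OF s], of "\<lambda>x. x \<bullet> x"] k'0[OF s] on'[OF s] by auto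
    then show ?thesis
      using arg_cong[OF eq3[OF s], of "\<lambda>x. x \<bullet> E\<^sub>\<phi> (\<sigma> s)"] on'[OF s]
      by (simp add: inner_commute)
  qed
  have sqV: "(E\<^sub>\<phi> (\<sigma> s) \<bullet> V s)\<^sup>2 = 1" if s: "s \<in> I" for s
  proof -
    define a b where "a = E\<^sub>\<phi> (\<sigma> s) \<bullet> T\<^sub>\<xi> s" and "b = E\<^sub>\<phi> (\<sigma> s) \<bullet> B\<^sub>\<xi> s"
    \<comment> \<open>Orthogonality to \<open>T\<^sub>\<phi>\<close> removes the
      \<open>N\<^sub>\<xi>\<close> component, which confines \<open>E\<^sub>\<phi>\<close> to the
      plane spanned by \<open>U\<close> and \<open>V\<close>.\<close>
    have "\<epsilon> * (E\<^sub>\<phi> (\<sigma> s) \<bullet> N\<^sub>\<xi> s) = 0"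
      using T'_N[OF s] on'[OF s] by (metis inner_commute inner_scaleR_right)
    then have "E\<^sub>\<phi> (\<sigma> s) \<bullet> N\<^sub>\<xi> s = 0" using \<epsilon> by auto
    then have E_eq: "E\<^sub>\<phi> (\<sigma> s) = a *\<^sub>R T\<^sub>\<xi> s + b *\<^sub>R B\<^sub>\<xi> s"
      using orthonormal_frame_expand[OF frame[OF s], of "E\<^sub>\<phi> (\<sigma> s)"] E'_E[OF s]
      by (simp add: a_def b_def)
    have ab: "a * a + b * b = 1"
      using on[OF s] on'[OF s] arg_cong[OF E_eq, of "\<lambda>x. x \<bullet> x"]
      by (simp add: inner_add_left inner_add_right inner_commute)
    have "\<delta> * (E\<^sub>\<phi> (\<sigma> s) \<bullet> U s) = 0"
      using N'_U[OF s] on'[OF s] by (metis inner_commute inner_scaleR_right)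
    then have "E\<^sub>\<phi> (\<sigma> s) \<bullet> U s = 0" using \<delta> by auto
    then have orthU: "kk / W * b - K / W * a = 0"
      by (simp add: U_def inner_add_right inner_diff_right a_def b_def)
    have "E\<^sub>\<phi> (\<sigma> s) \<bullet> V s = kk / W * a + K / W * b"
      by (simp add: V_def inner_add_right a_def b_def)
    \<comment> \<open>Pythagoras for the orthonormal pair \<open>V\<close>, \<open>U\<close>; the
      \<open>U\<close> component is zero by \<open>orthU\<close>.\<close>
    moreover have "(kk / W * a + K / W * b)\<^sup>2 + (kk / W * b - K / W * a)\<^sup>2 =
        (a * a + b * b) * (K / W * (K / W) + kk / W * (kk / W))"
      by (simp only: power2_eq_square) algebra
    ultimately show ?thesis unfolding orthU ab norm1[OF s] by simp
  qed
  have "\<exists>\<gamma>\<in>{1, - 1}. \<forall>s\<in>I. E\<^sub>\<phi> (\<sigma> s) = \<gamma> *\<^sub>R V s"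
    by (rule unit_fields_parallel_sign[OF conn cont_E' contV]) (auto simp: VV on' sqV)
  then obtain \<gamma> where \<gamma>: "\<gamma> \<in> {1, - 1}" and E'_V: "\<And>s. s \<in> I \<Longrightarrow> E\<^sub>\<phi> (\<sigma> s) = \<gamma> *\<^sub>R V s"
    by blast

  \<comment> \<open>Solving for the evolute\<close>
  have "\<xi> s = \<phi> (\<sigma> s) + (1 / \<kappa>\<^sub>\<phi> (\<sigma> s)) *\<^sub>R N\<^sub>\<phi> (\<sigma> s)
      - ((1 / \<kappa>\<^sub>\<phi> (\<sigma> s)) * (k s / \<kappa>\<^sub>\<xi> s)) *\<^sub>R ((\<delta> * \<gamma>) *\<^sub>R E\<^sub>\<phi> (\<sigma> s))" if s: "s \<in> I" for s
  proof -
    define p where "p = \<kappa>\<^sub>\<phi> (\<sigma> s)"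
    have nz: "W \<noteq> 0" "K \<noteq> 0" "p \<noteq> 0" using W0 \<kappa>0 \<kappa>'0 K s p_def by auto
    have "\<gamma> * \<gamma> = 1" using \<gamma> by auto
    \<comment> \<open>The choice \<open>\<delta> * \<gamma>\<close> of the sign \<eta> replaces
      \<gamma> by \<delta>, so that the two frame vectors in the formula carry the same sign
      \<delta>.\<close>
    then have E: "(\<delta> * \<gamma>) *\<^sub>R E\<^sub>\<phi> (\<sigma> s) = \<delta> *\<^sub>R V s"
      by (simp add: E'_V[OF s] mult.assoc)
    have "\<epsilon> * (\<mu> s * K * p) = \<epsilon> * (\<delta> * W)"
      using \<sigma>\<kappa>[OF s] \<sigma>'_eq[OF s] K[OF s] by (simp add: p_def algebra_simps)
    then have "\<mu> s * K * p = \<delta> * W" using \<epsilon> by auto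
    then have \<mu>: "\<mu> s = \<delta> * W / (K * p)" using nz by (simp add: field_simps)
    \<comment> \<open>The factor \<open>kk / K\<close> is what makes the
      \<open>B\<^sub>\<xi>\<close> components of \<open>U\<close> and \<open>V\<close> cancel,
      leaving a multiple of \<open>T\<^sub>\<xi>\<close>.\<close>
    have "N\<^sub>\<phi> (\<sigma> s) - (kk / K) *\<^sub>R (\<delta> *\<^sub>R V s) = - (\<delta> * ((K * K + kk * kk) / (K * W))) *\<^sub>R T\<^sub>\<xi> s"
      using nz unfolding N'_U[OF s] U_def V_def
      by (simp add: algebra_simps add_divide_distrib)
    also have "(K * K + kk * kk) / (K * W) = W / K"
      using nz by (simp flip: WW)
    finally have "(1 / p) *\<^sub>R (N\<^sub>\<phi> (\<sigma> s) - (kk / K) *\<^sub>R (\<delta> *\<^sub>R V s)) = - \<mu> s *\<^sub>R T\<^sub>\<xi> s"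
      by (simp add: \<mu>)
    then show ?thesis
      unfolding E \<phi>_eq[OF s] K[OF s] p_def[symmetric]
      by (simp add: scaleR_diff_right algebra_simps)
  qed
  moreover have "\<delta> * \<gamma> \<in> {1, - 1}" using \<delta> \<gamma> by auto
  ultimately show ?thesis unfolding Let_def by blast
qed

end
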